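(* Let $n,m\ge 0$ be integers with $2n+m\ge 3$, and let $\mathcal{P}_4$ denote the family of triangle-free planar simple graphs. Then $$\chi_{n,m}(\mathcal{P}_4)\ge 2(2n+m)^2+2.$$
   Context: An $(n,m)$-graph $G$ is a graph with $n$ different types of arcs (directed edges) and $m$ different types of edges (undirected), whose underlying graph $und(G)$ (forget types and directions) is a simple graph; each pair of adjacent vertices is joined by exactly one arc or edge, which has one type. A homomorphism of an $(n,m)$-graph $G$ to an $(n,m)$-graph $H$ is a map $f:V(G)\to V(H)$ such that for every arc $xy$ (from $x$ to $y$) of type $i$ in $G$, $f(x)f(y)$ is an arc of type $i$ from $f(x)$ to $f(y)$ in $H$, and for every edge $xy$ of type $j$ in $G$, $f(x)f(y)$ is an edge of type $j$ in $H$. The $(n,m)$-chromatic number of an $(n,m)$-graph $G$ is $\chi_{n,m}(G)=\min\{|V(H)|: H \text{ an } (n,m)\text{-graph and there is a homomorphism of } G \text{ to } H\}$. For a family $\mathcal{F}$ of simple graphs, $\chi_{n,m}(\mathcal{F})=\max\{\chi_{n,m}(G): G \text{ an } (n,m)\text{-graph with } und(G)\in\mathcal{F}\}$. *)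

theory Defs
  imports "HOL-Analysis.Analysis" "HOL-Library.Extended_Nat"
begin

section \<open>Finite simple graphs\<close>

text \<open>A graph is a pair \<open>(V, E)\<close>; an edge is the two-element set of its end vertices.\<close>

type_synonym 'a ugraph = "'a set \<times> 'a set set"

definition simple_graph :: "'a ugraph \<Rightarrow> bool" where
  "simple_graph = (\<lambda>(V, E). finite V \<and> (\<forall>e\<in>E. e \<subseteq> V \<and> card e = 2))"

text \<open>For simple graphs \<open>x, y, z\<close> below are automatically distinct.\<close>

definition triangle_free :: "'a ugraph \<Rightarrow> bool" where
  "triangle_free = (\<lambda>(V, E). \<not> (\<exists>x y z. {x, y} \<in> E \<and> {y, z} \<in> E \<and> {x, z} \<in> E))"

text \<open>
  A drawing in the Euclidean plane: \<open>p\<close> places the vertices at distinct points and \<open>\<gamma> e\<close> is a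
  simple arc joining the end points of \<open>e\<close>. No arc passes through the point of a further vertex,
  and two different arcs meet at most in the point of a common end vertex.
\<close>

definition plane_drawing :: "'a ugraph \<Rightarrow> ('a \<Rightarrow> real \<times> real) \<Rightarrow> ('a set \<Rightarrow> real \<Rightarrow> real \<times> real) \<Rightarrow> bool"
  where
  "plane_drawing = (\<lambda>(V, E) p \<gamma>.
     inj_on p V \<and>
     (\<forall>e\<in>E. arc (\<gamma> e) \<and>
            {pathstart (\<gamma> e), pathfinish (\<gamma> e)} = p ` e \<and>
            path_image (\<gamma> e) \<inter> p ` V = p ` e) \<and>
     (\<forall>e\<in>E. \<forall>e'\<in>E. e \<noteq> e' \<longrightarrow> path_image (\<gamma> e) \<inter> path_image (\<gamma> e') \<subseteq> p ` (e \<inter> e')))"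

definition planar :: "'a ugraph \<Rightarrow> bool" where
  "planar G \<longleftrightarrow> (\<exists>p \<gamma>. plane_drawing G p \<gamma>)"

definition triangle_free_planar_graphs :: "'a ugraph set" where
  "triangle_free_planar_graphs = {G. simple_graph G \<and> planar G \<and> triangle_free G}"

section \<open>Graphs with typed arcs and edges\<close>

text \<open>\<open>Arc i x y\<close> is an arc of type \<open>i\<close> from \<open>x\<close> to \<open>y\<close>; \<open>Edge j {x, y}\<close> is an edge of type \<open>j\<close>.\<close>

datatype 'a link = Arc nat 'a 'a | Edge nat "'a set"

fun ends :: "'a link \<Rightarrow> 'a set" where
  "ends (Arc i x y) = {x, y}"
| "ends (Edge j e) = e"

fun valid_type :: "nat \<Rightarrow> nat \<Rightarrow> 'a link \<Rightarrow> bool" where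
  "valid_type n m (Arc i x y) \<longleftrightarrow> i < n"
| "valid_type n m (Edge j e) \<longleftrightarrow> j < m"

record 'a nm_graph =
  verts :: "'a set"
  links :: "'a link set"

definition und :: "('a, 'b) nm_graph_scheme \<Rightarrow> 'a ugraph" where
  "und G = (verts G, ends ` links G)"

text \<open>
  Injectivity of \<open>ends\<close> says that adjacent vertices are joined by exactly one arc or edge, of
  exactly one type; in particular there are no pairs of opposite arcs.
\<close>

definition nm_graph :: "nat \<Rightarrow> nat \<Rightarrow> 'a nm_graph \<Rightarrow> bool" where
  "nm_graph n m G \<longleftrightarrow>
     simple_graph (und G) \<and> inj_on ends (links G) \<and> (\<forall>l\<in>links G. valid_type n m l)"

definition nm_hom :: "'a nm_graph \<Rightarrow> 'b nm_graph \<Rightarrow> ('a \<Rightarrow> 'b) \<Rightarrow> bool" where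
  "nm_hom G H f \<longleftrightarrow>
     f ` verts G \<subseteq> verts H \<and>
     (\<forall>i x y. Arc i x y \<in> links G \<longrightarrow> Arc i (f x) (f y) \<in> links H) \<and>
     (\<forall>j x y. Edge j {x, y} \<in> links G \<longrightarrow> Edge j {f x, f y} \<in> links H)"

text \<open>
  As targets are finite, it is enough to consider targets on natural numbers. For an
  \<open>(n, m)\<close>-graph the minimum exists, since a copy of the graph itself is a target.
\<close>

definition nm_chromatic :: "nat \<Rightarrow> nat \<Rightarrow> 'a nm_graph \<Rightarrow> nat" where
  "nm_chromatic n m G =
     (LEAST k. \<exists>(H :: nat nm_graph) f. nm_graph n m H \<and> card (verts H) = k \<and> nm_hom G H f)"

text \<open>
  The supremum in \<open>enat\<close> is the maximum whenever the values are bounded (and there are any), and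
  it is \<open>\<infinity>\<close> if they are unbounded.
\<close>

definition nm_chromatic_family :: "nat \<Rightarrow> nat \<Rightarrow> 'a ugraph set \<Rightarrow> enat" where
  "nm_chromatic_family n m F = (SUP G\<in>{G. nm_graph n m G \<and> und G \<in> F}. enat (nm_chromatic n m G))"

end

theory Submission
  imports Defs
begin

text \<open>
  Put \<open>p = 2 n + m\<close>. Seen from one of its end vertices, a link has one of \<open>p\<close> types, and two
  vertices joined to a common neighbour by links of different type have different images under every
  homomorphism. Let two hubs have \<open>2 p\<^sup>2\<close> common neighbours, two for each pair of types.
  Neighbours with different pairs are separated by a hub; the two neighbours with the same pair are
  drawn next to each other and separated by a private vertex placed between them. Hence the hubs and
  their neighbours have \<open>2 p\<^sup>2 + 2\<close> different images.
\<close>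

section \<open>Planarity of the double cone over a path\<close>

text \<open>Vertices 0 and 1 go to (0, 1) and (0, -1), every other vertex \<open>v\<close> to (v,
  0), and all edges are straight segments. A segment from a hub meets the axis only at its foot, and
  two segments from the same hub meet only in that hub.\<close>

lemma planar_double_cone_path:
  fixes V :: "nat set"
  assumes sub: "\<And>e. e \<in> E \<Longrightarrow> e \<subseteq> V"
    and edges: "\<And>e. e \<in> E \<Longrightarrow> \<exists>y\<ge>2. e = {0, y} \<or> e = {1, y} \<or> e = {y, Suc y}"
  shows "planar (V, E)"
proof -
  define p :: "nat \<Rightarrow> real \<times> real" where
    "p v = (if v = 0 then (0, 1) else if v = 1 then (0, - 1) else (real v, 0))" for v
  \<comment> \<open>\<open>Min\<close> and \<open>Max\<close> orient each segment away from its hub,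
    or from left to right on the axis; this fixes the parameter \<open>t\<close> in
    \<open>image\<close>.\<close>
  define \<gamma> where "\<gamma> e = linepath (p (Min e)) (p (Max e))" for e
  have inj: "inj p"
    by (auto simp: inj_def p_def)
  have ends: "\<exists>u v. u \<noteq> v \<and> e = {u, v} \<and> \<gamma> e = linepath (p u) (p v)" if e: "e \<in> E" for e
  proof -
    obtain y where "y \<ge> 2" "e = {0, y} \<or> e = {1, y} \<or> e = {y, Suc y}"
      using edges[OF e] by blast
    then have "0 < y" "1 < y" "y < Suc y"
      by simp_all
    then obtain u v where "e = {u, v}" "u < v"
      using \<open>e = {0, y} \<or> e = {1, y} \<or> e = {y, Suc y}\<close> by blast
    then show ?thesis
      by (intro exI[of _ u] exI[of _ v]) (auto simp: \<gamma>_def)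
  qed
  have image: "(\<exists>y t. y \<ge> 2 \<and> 0 \<le> t \<and> t \<le> 1 \<and>
      (e = {0, y} \<and> z = (t * real y, 1 - t) \<or> e = {1, y} \<and> z = (t * real y, t - 1) \<or>
       e = {y, Suc y} \<and> z = (real y + t, 0)))"
    if e: "e \<in> E" and z: "z \<in> path_image (\<gamma> e)" for e z
  proof -
    obtain y where y: "y \<ge> 2" "e = {0, y} \<or> e = {1, y} \<or> e = {y, Suc y}"
      using edges[OF e] by blast
    obtain t where t: "0 \<le> t" "t \<le> 1" "z = (1 - t) *\<^sub>R p (Min e) + t *\<^sub>R p (Max e)"
      using z by (auto simp: \<gamma>_def in_segment)
    have "e = {0, y} \<and> z = (t * real y, 1 - t) \<or> e = {1, y} \<and> z = (t * real y, t - 1) \<or>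
      e = {y, Suc y} \<and> z = (real y + t, 0)"
      using y(2)
    proof (elim disjE)
      assume "e = {0, y}"
      then show ?thesis
        using y(1) t(3) by (simp add: p_def)
    next
      assume "e = {1, y}"
      then show ?thesis
        using y(1) t(3) by (simp add: p_def)
    next
      assume "e = {y, Suc y}"
      then show ?thesis
        using y(1) t(3) by (simp add: p_def algebra_simps)
    qed
    then show ?thesis
      using y(1) t(1,2) by blast
  qed
  have vertex: "w \<in> e" if e: "e \<in> E" and w: "p w \<in> path_image (\<gamma> e)" for e w
  proof -
    obtain y t where yt: "y \<ge> 2" "0 \<le> t" "t \<le> 1"
      "e = {0, y} \<and> p w = (t * real y, 1 - t) \<or> e = {1, y} \<and> p w = (t * real y, t - 1) \<or>
       e = {y, Suc y} \<and> p w = (real y + t, 0)"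
      using image[OF e w] by blast
    have "w = y \<or> w = Suc y" if "w \<ge> 2" "real w = real y + t"
      using that yt(2,3) by linarith
    then show ?thesis
      using yt by (auto simp: p_def split: if_splits)
  qed
  have cross: "z \<in> p ` (e \<inter> e')"
    if e: "e \<in> E" "e' \<in> E" "e \<noteq> e'" and z: "z \<in> path_image (\<gamma> e)" "z \<in> path_image (\<gamma> e')" for e e' z
  proof -
    have p_eq: "p 0 = (0, 1)" "p 1 = (0, - 1)" "\<And>y. y \<ge> 2 \<Longrightarrow> p y = (real y, 0)"
      by (auto simp: p_def)
    \<comment> \<open>It is enough that a common point is the point of some vertex:
      \<open>vertex\<close>, applied to both edges, then puts this vertex into
      \<open>e \<inter> e'\<close>.\<close>
    have "\<exists>w. z = p w"
    proof -
      obtain y t where yt: "y \<ge> 2" "0 \<le> t" "t \<le> 1"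
        "e = {0, y} \<and> z = (t * real y, 1 - t) \<or> e = {1, y} \<and> z = (t * real y, t - 1) \<or>
         e = {y, Suc y} \<and> z = (real y + t, 0)"
        using image[OF e(1) z(1)] by blast
      obtain y' t' where yt': "y' \<ge> 2" "0 \<le> t'" "t' \<le> 1"
        "e' = {0, y'} \<and> z = (t' * real y', 1 - t') \<or> e' = {1, y'} \<and> z = (t' * real y', t' - 1) \<or>
         e' = {y', Suc y'} \<and> z = (real y' + t', 0)"
        using image[OF e(2) z(2)] by blast
      have z0: "\<exists>w. z = p w" if "z = (real k, 0)" "k \<ge> 2" for k
        using p_eq(3) that by metis
      have path: "t = 0 \<or> t = 1" if "y \<noteq> y'" "real y + t = real y' + t'"
        using that yt(2,3) yt'(2,3) by linarith
      have hub: "t = 0" if "y \<noteq> y'" "t * real y = t * real y'"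
        using that by auto
      \<comment> \<open>Off the axis, both edges start at the same hub, and equal heights with
        different feet force \<open>t = 0\<close>. On the axis, \<open>z\<close> is the foot of a
        hub segment or lies on two different path edges, so its abscissa is an integer.\<close>
      consider "snd z = 0" | "snd z > 0" | "snd z < 0"
        by linarith
      then show ?thesis
      proof cases
        case 1
        then have "z = (real y, 0) \<or> e = {y, Suc y} \<and> z = (real y + t, 0)"
          "z = (real y', 0) \<or> e' = {y', Suc y'} \<and> z = (real y' + t', 0)"
          using yt(4) yt'(4) by auto
        moreover have "z = (real y, 0) \<or> z = (real (Suc y), 0)"
          if "e = {y, Suc y}" "z = (real y + t, 0)" "e' = {y', Suc y'}" "z = (real y' + t', 0)"
        proof -
          have "t = 0 \<or> t = 1"
            using path that e(3) by auto
          then show ?thesis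
            using that(2) by auto
        qed
        ultimately have "z = (real y, 0) \<or> z = (real y', 0) \<or> z = (real (Suc y), 0)"
          by blast
        then show ?thesis
          using z0 yt(1) yt'(1) le_SucI by blast
      next
        case 2
        then have "e = {0, y} \<and> z = (t * real y, 1 - t)" "e' = {0, y'} \<and> z = (t' * real y', 1 - t')"
          using yt(2-4) yt'(2-4) by auto
        then have "z = (0, 1)"
          using hub e(3) by auto
        then show ?thesis
          using p_eq(1) by metis
      next
        case 3
        then have "e = {1, y} \<and> z = (t * real y, t - 1)" "e' = {1, y'} \<and> z = (t' * real y', t' - 1)"
          using yt(2-4) yt'(2-4) by auto
        then have "z = (0, - 1)"
          using hub e(3) by auto
        then show ?thesis
          using p_eq(2) by metis
      qed
    qed
    then show ?thesis
      using vertex e z by blast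
  qed
  have "plane_drawing (V, E) p \<gamma>"
    unfolding plane_drawing_def split
  proof (intro conjI ballI impI)
    show "inj_on p V"
      using inj by (rule inj_on_subset) simp
  next
    fix e assume e: "e \<in> E"
    obtain u v where uv: "u \<noteq> v" "e = {u, v}" "\<gamma> e = linepath (p u) (p v)"
      using ends[OF e] by blast
    show "arc (\<gamma> e)"
      using uv inj by (simp add: arc_linepath inj_eq)
    show "{pathstart (\<gamma> e), pathfinish (\<gamma> e)} = p ` e"
      using uv by simp
    have "p ` e \<subseteq> path_image (\<gamma> e)"
      using uv by simp
    then show "path_image (\<gamma> e) \<inter> p ` V = p ` e"
      using vertex[OF e] sub[OF e] by blast
  qed (use cross in blast)
  then show ?thesis
    unfolding planar_def by blast
qed

text \<open>Of the three vertices of a triangle, two would lie on the same side of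
  \<open>W\<close>.\<close>

lemma bipartite_triangle_free:
  assumes "\<And>x y. {x, y} \<in> E \<Longrightarrow> (x \<in> W) \<noteq> (y \<in> W)"
  shows "triangle_free (V, E)"
  using assms unfolding triangle_free_def split by blast

section \<open>Links seen from an end vertex\<close>

text \<open>A single number below \<open>2 * n + m\<close> records type and direction as seen from
  \<open>x\<close>: outgoing arcs first, then incoming arcs, then edges. Later arguments thus need
  no case distinction between arcs and edges.\<close>

definition link :: "nat \<Rightarrow> nat \<Rightarrow> 'a \<Rightarrow> 'a \<Rightarrow> 'a link" where
  "link n \<tau> x y =
     (if \<tau> < n then Arc \<tau> x y else if \<tau> < 2 * n then Arc (\<tau> - n) y x else Edge (\<tau> - 2 * n) {x, y})"

lemma ends_link [simp]: "ends (link n \<tau> x y) = {x, y}"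
  by (auto simp: link_def)

lemma valid_type_link: "\<tau> < 2 * n + m \<Longrightarrow> valid_type n m (link n \<tau> x y)"
  by (auto simp: link_def)

text \<open>At a loop, an outgoing and an incoming arc would be the same term, hence
  \<open>x \<noteq> y\<close>.\<close>

lemma link_inject: "x \<noteq> y \<Longrightarrow> link n \<sigma> x y = link n \<tau> x y \<Longrightarrow> \<sigma> = \<tau>"
  by (auto simp: link_def split: if_splits)

lemma nm_hom_link: "nm_hom G H f \<Longrightarrow> link n \<tau> x y \<in> links G \<Longrightarrow> link n \<tau> (f x) (f y) \<in> links H"
  by (auto simp: link_def nm_hom_def split: if_splits)

lemma link_irrefl:
  assumes "nm_graph n m H" "link n \<tau> x y \<in> links H"
  shows "x \<noteq> y"
proof -
  have "ends (link n \<tau> x y) \<in> ends ` links H"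
    using assms(2) by (rule imageI)
  then have "card {x, y} = 2"
    using assms(1) by (auto simp: nm_graph_def simple_graph_def und_def)
  then show ?thesis
    by auto
qed

lemma link_unique:
  assumes "nm_graph n m H" "link n \<sigma> x y \<in> links H" "link n \<tau> x y \<in> links H"
  shows "\<sigma> = \<tau>"
proof (rule link_inject)
  show "x \<noteq> y"
    using assms(1,2) by (rule link_irrefl)
  show "link n \<sigma> x y = link n \<tau> x y"
    using assms by (auto simp: nm_graph_def inj_on_def)
qed

lemma nm_hom_adjacent_neq:
  assumes "nm_graph n m H" "nm_hom G H f" "link n \<tau> x y \<in> links G"
  shows "f x \<noteq> f y"
  using link_irrefl[OF assms(1) nm_hom_link[OF assms(2,3)]] .

text \<open>Used in contraposed form: neighbours that \<open>x\<close> sees with different types are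
  separated by every homomorphism.\<close>

lemma nm_hom_out_eq:
  assumes "nm_graph n m H" "nm_hom G H f"
    and "link n \<sigma> x y \<in> links G" "link n \<tau> x z \<in> links G" "f y = f z"
  shows "\<sigma> = \<tau>"
  using link_unique[OF assms(1) nm_hom_link[OF assms(2,3)]] nm_hom_link[OF assms(2,4)] assms(5)
  by simp

text \<open>The same separation with the common neighbour in second position, as needed for the two
  hubs.\<close>

lemma nm_hom_in_eq:
  assumes "nm_graph n m H" "nm_hom G H f"
    and "link n \<sigma> x z \<in> links G" "link n \<tau> y z \<in> links G" "f x = f y"
  shows "\<sigma> = \<tau>"
  using link_unique[OF assms(1) nm_hom_link[OF assms(2,3)]] nm_hom_link[OF assms(2,4)] assms(5)
  by simp

lemma nm_chromatic_ge:
  fixes G :: "nat nm_graph"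
  assumes "nm_graph n m G"
    and "\<And>(H :: nat nm_graph) f. nm_graph n m H \<Longrightarrow> nm_hom G H f \<Longrightarrow> inj_on f R"
    and "R \<subseteq> verts G"
  shows "card R \<le> nm_chromatic n m G"
proof -
  let ?P = "\<lambda>k. \<exists>(H :: nat nm_graph) f. nm_graph n m H \<and> card (verts H) = k \<and> nm_hom G H f"
  \<comment> \<open>\<open>G\<close> is a target of itself, so the \<open>LEAST\<close> in the
    chromatic number is attained by an actual target \<open>H\<close>.\<close>
  have "nm_hom G G id"
    by (simp add: nm_hom_def)
  then have "?P (card (verts G))"
    using assms(1) by blast
  then have "?P (nm_chromatic n m G)"
    unfolding nm_chromatic_def by (rule LeastI)
  then obtain H :: "nat nm_graph" and f
    where H: "nm_graph n m H" "card (verts H) = nm_chromatic n m G" "nm_hom G H f"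
    by blast
  have "f ` R \<subseteq> verts H"
    using H(3) assms(3) by (auto simp: nm_hom_def)
  moreover have "finite (verts H)"
    using H(1) by (simp add: nm_graph_def simple_graph_def und_def)
  ultimately show ?thesis
    using card_inj_on_le[OF assms(2)[OF H(1,3)]] H(2) by metis
qed

section \<open>The extremal graph\<close>

text \<open>
  The hubs are \<open>0\<close> and \<open>1\<close>. For \<open>i < p\<^sup>2\<close> the neighbours \<open>3 * i + 2\<close> and \<open>3 * i + 4\<close> of the hubs
  have the pair of types \<open>(i div p, i mod p)\<close>, and \<open>3 * i + 3\<close> is their private vertex.
\<close>

definition hub_graph :: "nat \<Rightarrow> nat \<Rightarrow> nat nm_graph" where
  "hub_graph n p =
     \<lparr>verts = {..<3 * p\<^sup>2 + 2},
      links = (\<Union>i\<in>{..<p\<^sup>2}. \<Union>s\<in>{2, 4}.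
        {link n (i div p) 0 (3 * i + s), link n (i mod p) 1 (3 * i + s),
         link n (s div 4) (3 * i + 3) (3 * i + s)})\<rparr>"

text \<open>For \<open>s\<close> equal to 2 or 4, \<open>s div 4\<close> is 0 or 1, so the private
  vertex sees its two neighbours with different types.\<close>

lemma hub_graph_links:
  assumes "i < p\<^sup>2" "s \<in> {2, 4}"
  shows "link n (i div p) 0 (3 * i + s) \<in> links (hub_graph n p)"
    and "link n (i mod p) 1 (3 * i + s) \<in> links (hub_graph n p)"
    and "link n (s div 4) (3 * i + 3) (3 * i + s) \<in> links (hub_graph n p)"
  using assms unfolding hub_graph_def by auto

lemma hub_graph_linksE:
  assumes "l \<in> links (hub_graph n p)"
  obtains i s where "i < p\<^sup>2" "s = 2 \<or> s = 4"
    "l = link n (i div p) 0 (3 * i + s) \<or> l = link n (i mod p) 1 (3 * i + s) \<or>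
     l = link n (s div 4) (3 * i + 3) (3 * i + s)"
proof -
  have "\<exists>i s. i < p\<^sup>2 \<and> (s = 2 \<or> s = 4) \<and>
    (l = link n (i div p) 0 (3 * i + s) \<or> l = link n (i mod p) 1 (3 * i + s) \<or>
     l = link n (s div 4) (3 * i + 3) (3 * i + s))"
    using assms unfolding hub_graph_def nm_graph.simps by blast
  then show thesis
    using that by blast
qed

lemma und_hub_graph_edgeE:
  assumes "e \<in> snd (und (hub_graph n p))"
  obtains i s where "i < p\<^sup>2" "s = 2 \<or> s = 4"
    "e = {0, 3 * i + s} \<or> e = {1, 3 * i + s} \<or> e = {3 * i + 3, 3 * i + s}"
proof -
  obtain l where l: "l \<in> links (hub_graph n p)" "e = ends l"
    using assms by (auto simp: und_def)
  show thesis
    using l(1)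
  proof (rule hub_graph_linksE)
    fix i s assume k: "i < p\<^sup>2" "s = 2 \<or> s = 4"
      "l = link n (i div p) 0 (3 * i + s) \<or> l = link n (i mod p) 1 (3 * i + s) \<or>
       l = link n (s div 4) (3 * i + 3) (3 * i + s)"
    show thesis
      using k(3) l(2) by (intro that[OF k(1,2)]) (metis ends_link)
  qed
qed

lemma und_hub_graph_eq: "und (hub_graph n p) = ({..<3 * p\<^sup>2 + 2}, snd (und (hub_graph n p)))"
  by (simp add: und_def hub_graph_def)

lemma simple_graph_hub_graph: "simple_graph (und (hub_graph n p))"
proof -
  have "e \<subseteq> {..<3 * p\<^sup>2 + 2} \<and> card e = 2" if "e \<in> snd (und (hub_graph n p))" for e
    using that by (rule und_hub_graph_edgeE) auto
  then show ?thesis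
    by (subst und_hub_graph_eq) (simp add: simple_graph_def)
qed

lemma nm_graph_hub_graph:
  assumes p: "p = 2 * n + m" "p \<ge> 2"
  shows "nm_graph n m (hub_graph n p)"
  unfolding nm_graph_def
proof (intro conjI ballI)
  show "inj_on ends (links (hub_graph n p))"
  proof (rule inj_onI)
    fix l l' assume l: "l \<in> links (hub_graph n p)" and l': "l' \<in> links (hub_graph n p)"
      and eq: "ends l = ends l'"
    obtain i s where k: "s = 2 \<or> s = 4"
      "l = link n (i div p) 0 (3 * i + s) \<or> l = link n (i mod p) 1 (3 * i + s) \<or>
       l = link n (s div 4) (3 * i + 3) (3 * i + s)"
      using l by (rule hub_graph_linksE)
    obtain i' s' where k': "s' = 2 \<or> s' = 4"
      "l' = link n (i' div p) 0 (3 * i' + s') \<or> l' = link n (i' mod p) 1 (3 * i' + s') \<or>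
       l' = link n (s' div 4) (3 * i' + 3) (3 * i' + s')"
      using l' by (rule hub_graph_linksE)
    \<comment> \<open>Modulo 3, \<open>3 * i + s\<close> is 2 or 1 according to \<open>s\<close>, so
      it determines both numbers; private vertices have residue 0. Hence the end set of a link
      reveals which hub neighbour it contains.\<close>
    have 1: "i = i' \<and> s = s'" if "3 * i + s = 3 * i' + s'"
      using that k(1) k'(1) by presburger
    have 2: "3 * i + 3 \<noteq> 3 * i' + s'" "3 * i' + 3 \<noteq> 3 * i + s"
      using k(1) k'(1) by presburger+
    have "3 * i + s = 3 * i' + s'"
      using k k' eq 2 by (auto simp: doubleton_eq_iff)
    then show "l = l'"
      using k k' eq 1 by (auto simp: doubleton_eq_iff)
  qed
next
  fix l assume "l \<in> links (hub_graph n p)"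
  then obtain i s where k: "i < p\<^sup>2" "s = 2 \<or> s = 4"
      "l = link n (i div p) 0 (3 * i + s) \<or> l = link n (i mod p) 1 (3 * i + s) \<or>
       l = link n (s div 4) (3 * i + 3) (3 * i + s)"
    by (rule hub_graph_linksE)
  have "i div p < p"
    using k(1) by (simp add: less_mult_imp_div_less power2_eq_square)
  moreover have "i mod p < p" "s div 4 < p"
    using k(2) p(2) by auto
  ultimately have "i div p < 2 * n + m" "i mod p < 2 * n + m" "s div 4 < 2 * n + m"
    unfolding p(1) .
  then show "valid_type n m l"
    using k(3) valid_type_link by metis
qed (rule simple_graph_hub_graph)

lemma hub_graph_triangle_free_planar: "und (hub_graph n p) \<in> triangle_free_planar_graphs"
proof -
  let ?E = "snd (und (hub_graph n p))"
  have "planar ({..<3 * p\<^sup>2 + 2}, ?E)"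
  proof (rule planar_double_cone_path)
    fix e assume e: "e \<in> ?E"
    then show "e \<subseteq> {..<3 * p\<^sup>2 + 2}"
      by (rule und_hub_graph_edgeE) auto
    obtain i s where k: "s = 2 \<or> s = 4"
      "e = {0, 3 * i + s} \<or> e = {1, 3 * i + s} \<or> e = {3 * i + 3, 3 * i + s}"
      using e by (rule und_hub_graph_edgeE)
    \<comment> \<open>The private vertex lies between its neighbours in the path, so the smaller end
      is \<open>3 * i + 2\<close> for \<open>s = 2\<close> and \<open>3 * i + 3\<close> for
      \<open>s = 4\<close>.\<close>
    have "{3 * i + 3, 3 * i + s} = {3 * i + s div 4 + 2, Suc (3 * i + s div 4 + 2)}"
      "2 \<le> 3 * i + s" "2 \<le> 3 * i + s div 4 + 2"
      using k(1) by auto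
    then show "\<exists>y\<ge>2. e = {0, y} \<or> e = {1, y} \<or> e = {y, Suc y}"
      using k(2) by metis
  qed
  moreover have "triangle_free ({..<3 * p\<^sup>2 + 2}, ?E)"
  proof (rule bipartite_triangle_free)
    fix x y :: nat assume "{x, y} \<in> ?E"
    then obtain i s where k: "s = 2 \<or> s = 4"
      "{x, y} = {0, 3 * i + s} \<or> {x, y} = {1, 3 * i + s} \<or> {x, y} = {3 * i + 3, 3 * i + s}"
      by (rule und_hub_graph_edgeE)
    \<comment> \<open>One side of the bipartition consists of hub 1 and the multiples of 3, that is,
      hub 0 and the private vertices; the hub neighbours form the other side.\<close>
    have "\<not> 3 dvd 3 * i + s" "3 * i + s \<noteq> 1" "3 dvd 3 * i + 3"
      using k(1) by presburger+
    then show "(x \<in> {v. v = 1 \<or> 3 dvd v}) \<noteq> (y \<in> {v. v = 1 \<or> 3 dvd v})"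
      using k(2) by (auto simp: doubleton_eq_iff)
  qed
  ultimately show ?thesis
    using simple_graph_hub_graph[of n p] und_hub_graph_eq[of n p]
    by (simp add: triangle_free_planar_graphs_def)
qed

lemma hub_graph_hom_inj:
  assumes H: "nm_graph n m H" and f: "nm_hom (hub_graph n p) H f" and p: "p \<ge> 2"
  shows "inj_on f ({0, 1} \<union> (\<lambda>(i, s). 3 * i + s) ` ({..<p\<^sup>2} \<times> {2, 4}))"
proof -
  note out = nm_hom_out_eq[OF H f] and inn = nm_hom_in_eq[OF H f] and adj = nm_hom_adjacent_neq[OF H f]
  have p2: "1 < p\<^sup>2"
    using p by (intro one_less_power) simp_all
  \<comment> \<open>Index 1 has the pair of types (0, 1), so its neighbour 5 sees the two hubs with
    different types.\<close>
  have hubs: "f 0 \<noteq> f 1"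
  proof
    assume "f 0 = f 1"
    from inn[OF hub_graph_links(1,2)[OF p2, of 2] this] p show False
      by simp
  qed
  have hub: "f 0 \<noteq> f (3 * i + s)" "f 1 \<noteq> f (3 * i + s)" if "i < p\<^sup>2" "s \<in> {2, 4}" for i s
    using adj hub_graph_links(1,2)[OF that] by blast+
  have nbr: "3 * i + s = 3 * i' + s'"
    if k: "i < p\<^sup>2" "s \<in> {2, 4}" "i' < p\<^sup>2" "s' \<in> {2, 4}" and eq: "f (3 * i + s) = f (3 * i' + s')"
    for i s i' s'
  proof -
    \<comment> \<open>Hub 0 separates different quotients and hub 1 different remainders; together
      they determine the index.\<close>
    have "i div p = i' div p" "i mod p = i' mod p"
      using out hub_graph_links(1,2) k eq by metis+
    then have i: "i = i'"
      by (metis div_mult_mod_eq)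
    have "s div 4 = s' div 4"
      using out[OF hub_graph_links(3)[OF k(1,2)] hub_graph_links(3)[OF k(1,4)]] eq i by simp
    then show ?thesis
      using i k(2,4) by auto
  qed
  let ?N = "(\<lambda>(i, s). 3 * i + s) ` ({..<p\<^sup>2} \<times> {2, 4})"
  have "inj_on f {0, 1}"
    using hubs by (simp add: inj_on_def)
  moreover have "inj_on f ?N"
    by (rule inj_onI, clarify) (rule nbr; simp)
  moreover have "f x \<noteq> f y" if "x \<in> {0, 1}" "y \<in> ?N" for x y
  proof -
    obtain i s where "i < p\<^sup>2" "s \<in> {2, 4}" "y = 3 * i + s"
      using \<open>y \<in> ?N\<close> by (elim imageE SigmaE) simp
    then show ?thesis
      using hub[of i s] \<open>x \<in> {0, 1}\<close> by auto
  qed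
  then have "f ` {0, 1} \<inter> f ` ?N = {}"
    by blast
  ultimately show ?thesis
    unfolding inj_on_Un by blast
qed

text \<open>Residues modulo 3 make the \<open>2 * q\<close> neighbours distinct, and all are at
  least 2, so none is a hub. The set is a clique only in the sense that its images are pairwise
  distinct.\<close>

lemma card_hub_graph_clique:
  "card ({0, 1} \<union> (\<lambda>(i, s). 3 * i + s) ` ({..<q} \<times> {2, 4 :: nat})) = 2 * q + 2"
proof -
  have "inj_on (\<lambda>(i, s). 3 * i + s) ({..<q} \<times> {2, 4 :: nat})"
    unfolding inj_on_def by auto presburger+
  then have "card ((\<lambda>(i, s). 3 * i + s) ` ({..<q} \<times> {2, 4 :: nat})) = 2 * q"
    by (simp add: card_image card_cartesian_product)
  then show ?thesis
    by (subst card_Un_disjoint) auto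
qed

theorem theorem6:
  fixes n m :: nat
  assumes "2 * n + m \<ge> 3"
  shows "nm_chromatic_family n m (triangle_free_planar_graphs :: nat ugraph set)
           \<ge> enat (2 * (2 * n + m)\<^sup>2 + 2)"
proof -
  define p where "p = 2 * n + m"
  have p: "p \<ge> 2"
    using assms by (simp add: p_def)
  let ?G = "hub_graph n p"
  let ?R = "{0, 1} \<union> (\<lambda>(i, s). 3 * i + s) ` ({..<p\<^sup>2} \<times> {2, 4 :: nat})"
  have G: "nm_graph n m ?G"
    using p_def p by (rule nm_graph_hub_graph)
  have "card ?R \<le> nm_chromatic n m ?G"
  proof (rule nm_chromatic_ge[OF G])
    show "inj_on f ?R" if "nm_graph n m H" "nm_hom ?G H f" for H :: "nat nm_graph" and f
      using that p by (rule hub_graph_hom_inj)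
    show "?R \<subseteq> verts ?G"
      by (auto simp: hub_graph_def)
  qed
  then have "enat (2 * p\<^sup>2 + 2) \<le> enat (nm_chromatic n m ?G)"
    unfolding card_hub_graph_clique by simp
  also have "\<dots> \<le> nm_chromatic_family n m (triangle_free_planar_graphs :: nat ugraph set)"
    unfolding nm_chromatic_family_def
    by (rule SUP_upper) (simp add: G hub_graph_triangle_free_planar)
  finally show ?thesis
    unfolding p_def .
qed

end
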